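(* Let $\mathfrak{g}$ be a six-dimensional real Frobeniusian Lie algebra and let $\mathrm{d}\mu$ ($\mu\in\mathfrak{g}^*$) be a non-degenerate exact 2-form on $\mathfrak{g}$. Assume that the symplectic Lie algebra $(\mathfrak{g},\mathrm{d}\mu)$ has a Lagrangian ideal. Then, for every symplectic form $\omega$ on $\mathfrak{g}$, the symplectic Lie algebra $(\mathfrak{g},\omega)$ has at least one Lagrangian ideal.
   Context: All Lie algebras are finite-dimensional and real. A symplectic form on a Lie algebra $\mathfrak{g}$ is a non-degenerate skew-symmetric bilinear form $\omega$ with $\omega([x,y],z)+\omega([y,z],x)+\omega([z,x],y)=0$ for all $x,y,z\in\mathfrak{g}$; then $(\mathfrak{g},\omega)$ is called a symplectic Lie algebra. For $\mu\in\mathfrak{g}^*$, $\mathrm{d}\mu$ is the Chevalley-Eilenberg differential, $\mathrm{d}\mu(x,y)=-\mu([x,y])$. $\mathfrak{g}$ is Frobeniusian if some $\mathrm{d}\mu$ is non-degenerate. A Lagrangian ideal of $(\mathfrak{g},\omega)$ is an ideal $\mathfrak{j}$ of $\mathfrak{g}$ that is a maximal isotropic subspace for $\omega$, i.e. $\mathfrak{j}=\mathfrak{j}^{\perp_\omega}$. *)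

theory Defs
  imports "HOL-Analysis.Analysis"
begin

text \<open>
  A real Lie algebra is given by a bracket on a whole type of class \<open>real_vector\<close>.
  Dimension hypotheses are stated as \<^term>\<open>dim UNIV = n\<close>; since \<^term>\<open>dim\<close> is \<open>0\<close>
  when there is no finite basis, such an equation with \<open>n > 0\<close> entails finite dimension.
\<close>

locale lie_algebra =
  fixes br :: "'a::real_vector \<Rightarrow> 'a \<Rightarrow> 'a"
  assumes bilinear_br: "bilinear br"
    and br_self: "br x x = 0"
    and jacobi: "br x (br y z) + br y (br z x) + br z (br x y) = 0"

definition lie_ideal :: "('a::real_vector \<Rightarrow> 'a \<Rightarrow> 'a) \<Rightarrow> 'a set \<Rightarrow> bool" where
  "lie_ideal br J \<longleftrightarrow> subspace J \<and> (\<forall>x. \<forall>y\<in>J. br x y \<in> J)"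

definition skew_form :: "('a::real_vector \<Rightarrow> 'a \<Rightarrow> real) \<Rightarrow> bool" where
  "skew_form \<omega> \<longleftrightarrow> bilinear \<omega> \<and> (\<forall>x y. \<omega> x y = - \<omega> y x)"

text \<open>For skew forms, a trivial left radical is the same as a trivial right radical.\<close>

definition nondegenerate :: "('a::real_vector \<Rightarrow> 'a \<Rightarrow> real) \<Rightarrow> bool" where
  "nondegenerate \<omega> \<longleftrightarrow> (\<forall>x. (\<forall>y. \<omega> x y = 0) \<longrightarrow> x = 0)"

definition closed_form ::
  "('a::real_vector \<Rightarrow> 'a \<Rightarrow> 'a) \<Rightarrow> ('a \<Rightarrow> 'a \<Rightarrow> real) \<Rightarrow> bool" where
  "closed_form br \<omega> \<longleftrightarrow>
     (\<forall>x y z. \<omega> (br x y) z + \<omega> (br y z) x + \<omega> (br z x) y = 0)"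

definition symplectic_form ::
  "('a::real_vector \<Rightarrow> 'a \<Rightarrow> 'a) \<Rightarrow> ('a \<Rightarrow> 'a \<Rightarrow> real) \<Rightarrow> bool" where
  "symplectic_form br \<omega> \<longleftrightarrow> skew_form \<omega> \<and> nondegenerate \<omega> \<and> closed_form br \<omega>"

definition ce_diff ::
  "('a::real_vector \<Rightarrow> 'a \<Rightarrow> 'a) \<Rightarrow> ('a \<Rightarrow> real) \<Rightarrow> 'a \<Rightarrow> 'a \<Rightarrow> real" where
  "ce_diff br \<mu> x y = - \<mu> (br x y)"

definition frobeniusian :: "('a::real_vector \<Rightarrow> 'a \<Rightarrow> 'a) \<Rightarrow> bool" where
  "frobeniusian br \<longleftrightarrow> (\<exists>\<mu>. linear \<mu> \<and> nondegenerate (ce_diff br \<mu>))"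

definition form_perp :: "('a::real_vector \<Rightarrow> 'a \<Rightarrow> real) \<Rightarrow> 'a set \<Rightarrow> 'a set" where
  "form_perp \<omega> J = {x. \<forall>y\<in>J. \<omega> x y = 0}"

text \<open>
  For a skew form, the subspaces \<open>J\<close> with \<open>J = form_perp \<omega> J\<close> are exactly the
  maximal isotropic ones.
\<close>

definition lagrangian_ideal ::
  "('a::real_vector \<Rightarrow> 'a \<Rightarrow> 'a) \<Rightarrow> ('a \<Rightarrow> 'a \<Rightarrow> real) \<Rightarrow> 'a set \<Rightarrow> bool" where
  "lagrangian_ideal br \<omega> J \<longleftrightarrow> lie_ideal br J \<and> J = form_perp \<omega> J"

end

theory Submission
  imports Defs
begin

text \<open>
  Write \<open>\<Omega> = d\<mu>\<close> and let \<open>J\<close> be a Lagrangian ideal for \<open>\<Omega>\<close>; it is abelian of dimension three.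
  If a symplectic form \<open>\<omega>\<close> vanishes on \<open>J\<close>, then \<open>J\<close> is Lagrangian for \<open>\<omega>\<close> too. Otherwise the
  radical of \<open>\<omega>\<close> on \<open>J\<close> is a line \<open>\<real>k\<close>, which is again an ideal, and a different
  Lagrangian ideal has to be found.

  It is found in the spectrum of one derivation. As \<open>\<Omega>\<close> is nondegenerate, there is a principal
  element \<open>e\<close>, characterised by \<open>\<mu> [e,y] = - \<mu> y\<close>. Its adjoint map \<open>E\<close> satisfies
  \<open>\<Omega> (E x) y + \<Omega> x (E y) = - \<Omega> x y\<close>, so its eigenvalues come in pairs \<open>\<lambda>, - 1 - \<lambda>\<close>. On the plane
  \<open>J/\<real>k\<close> the map \<open>E\<close> infinitesimally preserves the area form induced by \<open>\<omega>\<close>, so it is traceless and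
  \<open>E\<^sup>2 = m\<close> for some real \<open>m = \<delta>\<^sup>2\<close>. The eigenvalues of \<open>E\<close> are therefore \<open>- 1, \<delta>, - \<delta>\<close> on \<open>J\<close> and, by the
  pairing, \<open>0, - 1 - \<delta>, - 1 + \<delta>\<close> on the quotient by \<open>J\<close>.

  Closedness of \<open>\<omega>\<close> gives \<open>\<omega> (E x) y + \<omega> x (E y) = 0\<close> whenever \<open>x\<close> and \<open>y\<close> commute. So an abelian ideal
  \<open>I\<close> on which no two eigenvalues of \<open>E\<close> add up to zero is isotropic for \<open>\<omega>\<close>, and if its
  dimension is three it is Lagrangian. For \<open>m > 0\<close>, with \<open>\<delta> > 0\<close>, such an ideal is the one with
  eigenvalues \<open>- 1, - \<delta>, - 1 - \<delta>\<close>; for \<open>m \<le> 0\<close> it is the one with eigenvalues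
  \<open>- 1, - 1 - \<delta>, - 1 + \<delta>\<close>, all of real part \<open>- 1\<close>. That these are abelian ideals holds because a
  bracket adds eigenvalues, and every unwanted component of a bracket would belong to a sum that is
  not an eigenvalue there.

  The proof avoids decomposing the algebra into generalised eigenspaces. In both cases \<open>I\<close> is cut
  out by three linear functionals, which makes its dimension at least three, and the unwanted
  components are killed by the following device: a functional \<open>\<theta>\<close> that vanishes on \<open>J\<close> and obeys
  \<open>\<theta> (E x) = c * \<theta> x\<close> on the centraliser of \<open>k\<close> is zero there unless \<open>c\<close> is one of the eigenvalues
  \<open>- 1 \<plusminus> \<delta>\<close>. For \<open>m \<le> 0\<close> the eigenvalue \<open>c\<close> may be imaginary, and its place is taken by a linear
  recurrence. The spectrum is obtained in \<open>\<Omega>_E\<close>, \<open>E_square_J\<close> and \<open>F_square_N\<close>; the two ideals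
  are Lagrangian by the lemmas \<open>real_spectrum.lagrangian_I\<close> and \<open>imaginary_spectrum.lagrangian_I\<close>.
\<close>

section \<open>Finite-dimensional real vector spaces and nondegenerate forms\<close>

lemma finite_dimensional_basis:
  assumes "dim (UNIV :: 'a::real_vector set) > 0"
  obtains B :: "'a::real_vector set" where "finite B" "independent B" "span B = UNIV"
proof -
  obtain B :: "'a set" where B: "independent B" "UNIV \<subseteq> span B" "card B = dim (UNIV :: 'a set)"
    by (rule basis_exists[of "UNIV :: 'a set"])
  then have "finite B" using assms by (metis card.infinite less_numeral_extra(3))
  then show ?thesis using that B by auto
qed

text \<open>
  A real vector space whose dimension is only known to be a positive number has some finite basis,
  and so inherits the theory of finite-dimensional spaces from the locale of spaces with a
  distinguished one.
\<close>

lemma finite_dimensional_facts: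
  assumes fin: "dim (UNIV :: 'a::real_vector set) > 0"
  shows real_independent_card_le_dim:
      "\<And>B V :: 'a::real_vector set. B \<subseteq> V \<Longrightarrow> independent B \<Longrightarrow> finite B \<and> card B \<le> dim V"
    and real_dim_insert_le: "\<And>(x :: 'a::real_vector) S. dim (insert x S) \<le> dim S + 1"
    and real_dim_mono: "\<And>V W :: 'a::real_vector set. V \<subseteq> span W \<Longrightarrow> dim V \<le> dim W"
    and real_subspace_dim_equal:
      "\<And>S T :: 'a::real_vector set. subspace S \<Longrightarrow> subspace T \<Longrightarrow> S \<subseteq> T \<Longrightarrow> dim T \<le> dim S \<Longrightarrow> S = T"
    and real_linear_inj_surj: "\<And>f :: 'a::real_vector \<Rightarrow> 'a. linear f \<Longrightarrow> inj f \<Longrightarrow> surj f"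
    and real_dim_image_eq: "\<And>(f :: 'a::real_vector \<Rightarrow> 'a) S. linear f \<Longrightarrow> inj f \<Longrightarrow> dim (f ` S) = dim S"
proof -
  obtain B0 :: "'a set" where B0: "finite B0" "independent B0" "span B0 = UNIV"
    using finite_dimensional_basis[OF fin] .
  interpret fd: finite_dimensional_vector_space "scaleR :: real \<Rightarrow> 'a \<Rightarrow> 'a" B0
    rewrites "module.dependent ((*\<^sub>R) :: real \<Rightarrow> 'a \<Rightarrow> 'a) = dependent"
      and "module.subspace ((*\<^sub>R) :: real \<Rightarrow> 'a \<Rightarrow> 'a) = subspace"
      and "module.span ((*\<^sub>R) :: real \<Rightarrow> 'a \<Rightarrow> 'a) = span"
      and "vector_space.dim ((*\<^sub>R) :: real \<Rightarrow> 'a \<Rightarrow> 'a) = dim"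
      and "Vector_Spaces.linear (*\<^sub>R) ((*\<^sub>R) :: real \<Rightarrow> 'a \<Rightarrow> 'a) = linear"
    using B0
    by (unfold_locales)
      (auto simp add: dependent_raw_def subspace_raw_def span_raw_def dim_raw_def linear_def)
  show "finite B \<and> card B \<le> dim V" if "B \<subseteq> V" "independent B" for B V :: "'a set"
    using that fd.independent_card_le_dim fd.finiteI_independent by blast
  show "dim (insert x S) \<le> dim S + 1" for x :: 'a and S
    by (simp add: fd.dim_insert)
  show "dim V \<le> dim W" if "V \<subseteq> span W" for V W :: "'a set"
    using that by (rule fd.dim_mono)
  show "S = T" if "subspace S" "subspace T" "S \<subseteq> T" "dim T \<le> dim S" for S T :: "'a set"
    using that by (rule fd.subspace_dim_equal)
  show "surj f" if "linear f" "inj f" for f :: "'a \<Rightarrow> 'a"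
    using that by (rule fd.linear_inj_imp_surj)
  interpret fp: finite_dimensional_vector_space_pair_1 "scaleR :: real \<Rightarrow> 'a \<Rightarrow> 'a" B0
      "scaleR :: real \<Rightarrow> 'a \<Rightarrow> 'a"
    by unfold_locales
  show "dim (f ` S) = dim S" if f: "linear f" "inj f" for f :: "'a \<Rightarrow> 'a" and S
    using fp.dim_image_eq[of f S] f inj_on_subset[OF f(2) subset_UNIV]
    by (simp add: dim_raw_def linear_def)
qed

lemma dim_nonzero_ex: "dim V \<noteq> 0 \<Longrightarrow> \<exists>x\<in>V. x \<noteq> (0 :: 'a::real_vector)"
  using real_vector.dim_unique[of "{}" V 0] by (auto simp: real_vector.independent_empty)

lemma dim_kernel_functional:
  fixes f :: "'a::real_vector \<Rightarrow> real" and V :: "'a set"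
  assumes fin: "dim (UNIV :: 'a set) > 0" and V: "subspace V" and f: "linear f"
  shows "dim V \<le> dim {x\<in>V. f x = 0} + 1"
proof (cases "\<forall>x\<in>V. f x = 0")
  case True
  then have "{x\<in>V. f x = 0} = V" by auto
  then show ?thesis by simp
next
  case False
  then obtain v where v: "v \<in> V" "f v \<noteq> 0" by auto
  have "V \<subseteq> span (insert v {x\<in>V. f x = 0})"
  proof
    fix x assume x: "x \<in> V"
    have "x - (f x / f v) *\<^sub>R v \<in> {x\<in>V. f x = 0}"
      using x v V f by (simp add: subspace_diff subspace_scale linear_diff linear_cmul)
    then show "x \<in> span (insert v {x\<in>V. f x = 0})"
      by (meson span_breakdown_eq span_base)
  qed
  then have "dim V \<le> dim (insert v {x\<in>V. f x = 0})" by (rule real_dim_mono[OF fin])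
  also have "\<dots> \<le> dim {x\<in>V. f x = 0} + 1" by (rule real_dim_insert_le[OF fin])
  finally show ?thesis .
qed

lemma subspace_kernel_functional:
  assumes "subspace V" "linear (f :: 'a::real_vector \<Rightarrow> real)"
  shows "subspace {x\<in>V. f x = 0}"
  using assms by (auto simp: subspace_def linear_add linear_cmul linear_0)

lemma bilinear_linear_left: "bilinear h \<Longrightarrow> linear (\<lambda>x. h x y)"
  and bilinear_linear_right: "bilinear h \<Longrightarrow> linear (\<lambda>y. h x y)"
  by (auto simp: bilinear_def)

lemma subspace_form_perp:
  assumes "bilinear w" shows "subspace (form_perp w S)"
  using assms
  by (auto simp: subspace_def form_perp_def bilinear_ladd bilinear_lmul bilinear_lzero)

text \<open>
  Extend a basis of \<open>S\<close> to a basis \<open>B\<close> of the whole space. Nondegeneracy says that the map sending \<open>x\<close> to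
  the vector with \<open>B\<close>-coordinates \<open>w x b\<close> is injective, hence bijective, and it carries the
  orthogonal of \<open>S\<close> onto the span of the basis vectors outside \<open>S\<close>.
\<close>

lemma dim_form_perp:
  fixes w :: "'a::real_vector \<Rightarrow> 'a \<Rightarrow> real"
  assumes fin: "dim (UNIV :: 'a set) > 0" and w: "bilinear w" "nondegenerate w"
    and S: "subspace S"
  shows "dim (form_perp w S) + dim S = dim (UNIV :: 'a set)"
proof -
  obtain C where C: "C \<subseteq> S" "independent C" "S \<subseteq> span C" "card C = dim S"
    by (rule basis_exists[of S])
  obtain B where "C \<subseteq> B" "B \<subseteq> UNIV" "independent B" "UNIV \<subseteq> span B"
    by (rule maximal_independent_subset_extend[OF subset_UNIV C(2)])
  then have B: "C \<subseteq> B" "independent B" "span B = UNIV" by auto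
  have finB: "finite B" using real_independent_card_le_dim[OF fin subset_UNIV B(2)] by simp
  have cardB: "card B = dim (UNIV :: 'a set)"
    using dim_unique[OF subset_UNIV _ B(2) refl] B(3) by simp
  have spC: "span C = S" using C S by (simp add: span_minimal subset_antisym)
  define T where "T x = (\<Sum>b\<in>B. w x b *\<^sub>R b)" for x
  have linT: "linear T"
    unfolding T_def
    by (rule linearI)
      (simp_all add: bilinear_ladd[OF w(1)] bilinear_lmul[OF w(1)] scaleR_add_left
        sum.distrib scaleR_sum_right)
  have vanish: "w x y = 0" if "\<And>b. b \<in> D \<Longrightarrow> w x b = 0" "y \<in> span D" for x y D
    using linear_eq_0_on_span[OF bilinear_linear_right[OF w(1)], of D x y] that by blast
  have "inj T"
  proof (rule linear_injective_0[OF linT, THEN iffD2], intro allI impI)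
    fix x assume "T x = 0"
    then have "\<forall>b\<in>B. w x b = 0"
      using B(2) finB unfolding T_def by (auto simp: independent_explicit_finite_subsets)
    then show "x = 0"
      using w(2) vanish[of B x] B(3) unfolding nondegenerate_def by blast
  qed
  then have surT: "surj T" using real_linear_inj_surj[OF fin linT] by simp
  have img: "T ` form_perp w S = span (B - C)"
  proof (rule set_eqI, rule iffI)
    fix z assume "z \<in> T ` form_perp w S"
    then obtain x where x: "x \<in> form_perp w S" "z = T x" by auto
    have "T x = (\<Sum>b\<in>B - C. w x b *\<^sub>R b)"
      unfolding T_def
      by (rule sum.mono_neutral_right) (use finB x C in \<open>auto simp: form_perp_def\<close>)
    then show "z \<in> span (B - C)"
      unfolding x(2) by (simp only:) (intro span_sum span_scale span_base)
  next
    fix z assume z: "z \<in> span (B - C)"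
    obtain x where x: "z = T x" using surT by (metis surjD)
    obtain u where u: "z = (\<Sum>b\<in>B - C. u b *\<^sub>R b)"
      using z finB by (auto simp: span_finite)
    define u' where "u' b = (if b \<in> C then 0 else u b)" for b
    have "z = (\<Sum>b\<in>B. u' b *\<^sub>R b)"
      unfolding u
      by (rule sum.mono_neutral_cong_left) (use finB in \<open>auto simp: u'_def\<close>)
    then have "(\<Sum>b\<in>B. (w x b - u' b) *\<^sub>R b) = 0"
      using x by (simp add: T_def scaleR_left_diff_distrib sum_subtractf)
    then have "\<forall>b\<in>B. w x b = u' b"
      using B(2) finB by (force simp: independent_explicit_finite_subsets)
    then have "\<And>b. b \<in> C \<Longrightarrow> w x b = 0" using B(1) by (auto simp: u'_def)
    then have "x \<in> form_perp w S"
      using vanish[of C x] C(3) unfolding form_perp_def by blast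
    then show "z \<in> T ` form_perp w S" using x by blast
  qed
  have "dim (form_perp w S) = dim (T ` form_perp w S)"
    using real_dim_image_eq[OF fin linT \<open>inj T\<close>] by simp
  also have "\<dots> = card (B - C)"
    unfolding img using B(2) by (simp add: dim_eq_card_independent independent_mono)
  also have "\<dots> = card B - card C"
    using B(1) finB by (simp add: card_Diff_subset finite_subset)
  finally show ?thesis
    using C(4) cardB card_mono[OF finB B(1)] by simp
qed

text \<open>
  The orthogonal of the kernel of \<open>f\<close> contains a nonzero vector because the kernel is a proper
  subspace; pairing with that vector is proportional to \<open>f\<close>.
\<close>

lemma nondegenerate_represents_functional:
  fixes w :: "'a::real_vector \<Rightarrow> 'a \<Rightarrow> real"
  assumes fin: "dim (UNIV :: 'a set) > 0" and w: "bilinear w" "nondegenerate w"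
    and f: "linear f"
  obtains e where "\<And>y. w e y = f y"
proof (cases "\<forall>y. f y = 0")
  case True
  then show ?thesis using that[of 0] by (simp add: bilinear_lzero[OF w(1)])
next
  case False
  then obtain v where v: "f v \<noteq> 0" by auto
  define H where "H = {y. f y = 0}"
  have H: "subspace H"
    using subspace_kernel_functional[OF subspace_UNIV f] by (simp add: H_def)
  have "dim H \<noteq> dim (UNIV :: 'a set)"
    using real_subspace_dim_equal[OF fin H subspace_UNIV] v unfolding H_def by force
  then have "dim (form_perp w H) \<noteq> 0"
    using dim_form_perp[OF fin w H] by linarith
  then obtain p where p: "p \<in> form_perp w H" "p \<noteq> 0" using dim_nonzero_ex by blast
  have wp: "w p y = (f y / f v) * w p v" for y
  proof -
    have "y - (f y / f v) *\<^sub>R v \<in> H"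
      using v by (simp add: H_def linear_diff[OF f] linear_cmul[OF f])
    then have "w p (y - (f y / f v) *\<^sub>R v) = 0" using p by (simp add: form_perp_def)
    then show ?thesis by (simp add: bilinear_rsub[OF w(1)] bilinear_rmul[OF w(1)])
  qed
  have "w p v \<noteq> 0"
  proof
    assume "w p v = 0"
    then have "w p y = 0" for y by (subst wp) simp
    then show False using p(2) w(2) unfolding nondegenerate_def by blast
  qed
  then have "w ((f v / w p v) *\<^sub>R p) y = f y" for y
    using v by (subst bilinear_lmul[OF w(1)], subst wp) simp
  then show ?thesis by (rule that)
qed

lemma isotropic_half_dim_eq_perp:
  fixes w :: "'a::real_vector \<Rightarrow> 'a \<Rightarrow> real"
  assumes fin: "dim (UNIV :: 'a set) > 0" and w: "bilinear w" "nondegenerate w"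
    and I: "subspace I" "I \<subseteq> form_perp w I"
    and big: "dim (UNIV :: 'a set) \<le> 2 * dim I"
  shows "I = form_perp w I"
proof (rule real_subspace_dim_equal[OF fin I(1) subspace_form_perp[OF w(1)] I(2)])
  show "dim (form_perp w I) \<le> dim I"
    using dim_form_perp[OF fin w I(1)] big by linarith
qed

lemma dim_three_functionals:
  fixes f g h :: "'a::real_vector \<Rightarrow> real"
  assumes fin: "dim (UNIV :: 'a set) > 0" and "linear f" "linear g" "linear h"
    and sub: "\<And>x. f x = 0 \<Longrightarrow> g x = 0 \<Longrightarrow> h x = 0 \<Longrightarrow> x \<in> I"
  shows "dim (UNIV :: 'a set) \<le> dim I + 3"
proof -
  let ?F = "{x\<in>UNIV. f x = 0}" let ?G = "{x\<in>?F. g x = 0}" let ?H = "{x\<in>?G. h x = 0}"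
  have F: "subspace ?F" by (rule subspace_kernel_functional[OF subspace_UNIV assms(2)])
  have G: "subspace ?G" by (rule subspace_kernel_functional[OF F assms(3)])
  have "dim (UNIV :: 'a set) \<le> dim ?F + 1"
    by (rule dim_kernel_functional[OF fin subspace_UNIV assms(2)])
  moreover have "dim ?F \<le> dim ?G + 1" by (rule dim_kernel_functional[OF fin F assms(3)])
  moreover have "dim ?G \<le> dim ?H + 1" by (rule dim_kernel_functional[OF fin G assms(4)])
  moreover have "dim ?H \<le> dim I"
    by (rule real_dim_mono[OF fin]) (use sub in \<open>auto intro: span_base\<close>)
  ultimately show ?thesis by linarith
qed

text \<open>
  A skew form has even rank, so a nonzero one on a space of dimension three has a radical of dimension
  one. The second property of \<open>k\<close> says that the radical is already the common orthogonal of any two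
  vectors that do not pair to zero: these two, \<open>k\<close> and a further vector of that orthogonal outside
  \<open>\<real>k\<close> would be linearly independent.
\<close>

lemma dim_3_radical:
  fixes w :: "'a::real_vector \<Rightarrow> 'a \<Rightarrow> real"
  assumes fin: "dim (UNIV :: 'a set) > 0" and w: "skew_form w"
    and J: "subspace J" "dim J = 3" and uv: "u \<in> J" "v \<in> J" "w u v \<noteq> 0"
  obtains k where "k \<in> J" "k \<noteq> 0" "\<And>x. x \<in> J \<Longrightarrow> w k x = 0"
    "\<And>a b x. a \<in> J \<Longrightarrow> b \<in> J \<Longrightarrow> w a b \<noteq> 0 \<Longrightarrow> x \<in> J \<Longrightarrow> w a x = 0 \<Longrightarrow> w b x = 0
      \<Longrightarrow> \<exists>c. x = c *\<^sub>R k"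
proof -
  have b: "bilinear w" and skew: "w x y = - w y x" for x y
    using w unfolding skew_form_def by blast+
  have self: "w x x = 0" for x using skew[of x x] by simp
  have line: "\<exists>c. x = c *\<^sub>R y"
    if "a \<in> J" "b \<in> J" "w a b \<noteq> 0" "x \<in> J" "w a x = 0" "w b x = 0"
      "y \<in> J" "w a y = 0" "w b y = 0" "y \<noteq> 0" for a b x y
  proof (rule ccontr)
    assume "\<nexists>c. x = c *\<^sub>R y"
    then have x: "x \<notin> span {y}" by (auto simp: span_singleton)
    have z: "w d z = 0" if "z \<in> span S" "\<And>s. s \<in> S \<Longrightarrow> w d s = 0" for d z S
      using linear_eq_0_on_span[OF bilinear_linear_right[OF b], of S d z] that by blast
    have b': "b \<notin> span {x, y}" using z[of b "{x,y}" a] that by blast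
    have "w b a \<noteq> 0" using that skew[of b a] by simp
    then have a': "a \<notin> span {b, x, y}"
      using z[of a "{b,x,y}" b] that self by blast
    have sep: "x \<notin> {y}" "b \<notin> {x, y}" "a \<notin> {b, x, y}"
      using x b' a' span_superset[of "{y}"] span_superset[of "{x, y}"] span_superset[of "{b, x, y}"]
      by auto
    have "independent {y}" using \<open>y \<noteq> 0\<close> by simp
    then have "independent {x, y}" using x by (rule independent_insertI[rotated])
    then have "independent {b, x, y}" using b' by (rule independent_insertI[rotated])
    then have "independent {a, b, x, y}" using a' by (rule independent_insertI[rotated])
    moreover have "card {a, b, x, y} = 4"
      using sep by simp
    moreover have "{a, b, x, y} \<subseteq> J" using that by simp
    ultimately show False
      using real_independent_card_le_dim[OF fin, of "{a,b,x,y}" J] J(2) by simp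
  qed
  let ?F = "{x\<in>J. w u x = 0}" let ?G = "{x\<in>?F. w v x = 0}"
  have F: "subspace ?F" by (rule subspace_kernel_functional[OF J(1) bilinear_linear_right[OF b]])
  have "dim J \<le> dim ?F + 1"
    by (rule dim_kernel_functional[OF fin J(1) bilinear_linear_right[OF b]])
  moreover have "dim ?F \<le> dim ?G + 1"
    by (rule dim_kernel_functional[OF fin F bilinear_linear_right[OF b]])
  ultimately have "dim ?G \<noteq> 0" using J(2) by simp
  then obtain k where k: "k \<in> J" "w u k = 0" "w v k = 0" "k \<noteq> 0"
    using dim_nonzero_ex[of ?G] by auto
  have rad: "w k x = 0" if x: "x \<in> J" for x
  proof -
    define r where "r = x - (w x v / w u v) *\<^sub>R u - (w u x / w u v) *\<^sub>R v"
    have "r \<in> J" using x uv J(1) by (simp add: r_def subspace_diff subspace_scale)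
    moreover have "w u r = 0" "w v r = 0"
      using uv(3) skew[of v u] skew[of v x]
      by (simp_all add: r_def bilinear_rsub[OF b] bilinear_rmul[OF b] self)
    ultimately obtain c where c: "r = c *\<^sub>R k" using line[OF uv _ _ _ k(1-4)] by blast
    have x_eq: "x = (w x v / w u v) *\<^sub>R u + (w u x / w u v) *\<^sub>R v + c *\<^sub>R k"
      unfolding c[symmetric] by (simp add: r_def)
    have "w k u = 0" "w k v = 0" using k skew[of k u] skew[of k v] by simp_all
    then show ?thesis
      by (subst x_eq) (simp add: bilinear_radd[OF b] bilinear_rmul[OF b] self)
  qed
  show ?thesis
  proof (rule that[OF k(1,4) rad])
    fix a b x
    assume "a \<in> J" "b \<in> J" "w a b \<noteq> 0" "x \<in> J" "w a x = 0" "w b x = 0"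
    moreover have "w a k = 0" "w b k = 0"
      using calculation rad skew[of a k] skew[of b k] by auto
    ultimately show "\<exists>c. x = c *\<^sub>R k" using line[of a b x k] k by blast
  qed
qed

section \<open>Symplectic forms on Lie algebras\<close>

lemma symplectic_formD:
  assumes "symplectic_form br w"
  shows "bilinear w" "nondegenerate w" "w x y = - w y x"
    "w (br x y) z + w (br y z) x + w (br z x) y = 0"
proof -
  have w: "skew_form w" "nondegenerate w" "closed_form br w"
    using assms by (simp_all add: symplectic_form_def)
  show "bilinear w" using w(1) by (simp add: skew_form_def)
  show "w x y = - w y x" using w(1) unfolding skew_form_def by (elim conjE allE)
  show "nondegenerate w" by fact
  show "w (br x y) z + w (br y z) x + w (br z x) y = 0" using w(3) by (simp add: closed_form_def)
qed

lemma lagrangian_idealD: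
  assumes "lagrangian_ideal br w J"
  shows "lie_ideal br J" "x \<in> J \<longleftrightarrow> (\<forall>y\<in>J. w x y = 0)"
proof -
  have J: "lie_ideal br J \<and> J = form_perp w J" using assms by (simp only: lagrangian_ideal_def)
  show "lie_ideal br J" by (rule conjunct1[OF J])
  have "x \<in> J \<longleftrightarrow> x \<in> form_perp w J" by (rule arg_cong[OF conjunct2[OF J]])
  then show "x \<in> J \<longleftrightarrow> (\<forall>y\<in>J. w x y = 0)" by (simp only: form_perp_def mem_Collect_eq)
qed

lemma (in lie_algebra) br_skew: "br x y = - br y x"
proof -
  have "br (x + y) (x + y) = br x y + br y x"
    by (simp only: bilinear_ladd[OF bilinear_br] bilinear_radd[OF bilinear_br]) (simp add: br_self)
  then show ?thesis by (simp add: br_self eq_neg_iff_add_eq_0)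
qed

lemma (in lie_algebra) br_derivation: "br x (br y z) = br (br x y) z + br y (br x z)"
proof -
  have "br y (br z x) = - br y (br x z)"
    by (subst br_skew[of z x]) (simp add: bilinear_rneg[OF bilinear_br])
  moreover have "br z (br x y) = - br (br x y) z" by (rule br_skew)
  ultimately show ?thesis using jacobi[of x y z] by (simp add: algebra_simps)
qed

lemmas (in lie_algebra) br_linear [simp] =
  bilinear_ladd[OF bilinear_br] bilinear_radd[OF bilinear_br]
  bilinear_lmul[OF bilinear_br] bilinear_rmul[OF bilinear_br]
  bilinear_lneg[OF bilinear_br] bilinear_rneg[OF bilinear_br]
  bilinear_lsub[OF bilinear_br] bilinear_rsub[OF bilinear_br]
  bilinear_lzero[OF bilinear_br] bilinear_rzero[OF bilinear_br]

lemma (in lie_algebra) symplectic_ce_diff: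
  assumes "linear \<mu>" "nondegenerate (ce_diff br \<mu>)"
  shows "symplectic_form br (ce_diff br \<mu>)"
proof -
  interpret \<mu>: linear \<mu> by fact
  have b: "bilinear (ce_diff br \<mu>)"
    unfolding bilinear_def ce_diff_def
    by (auto intro!: linearI simp: \<mu>.add \<mu>.scale)
  have s: "ce_diff br \<mu> x y = - ce_diff br \<mu> y x" for x y
    unfolding ce_diff_def by (subst br_skew) (simp add: \<mu>.neg)
  have c: "ce_diff br \<mu> (br x y) z + ce_diff br \<mu> (br y z) x + ce_diff br \<mu> (br z x) y = 0" for x y z
  proof -
    have "\<mu> (br (br x y) z + br (br y z) x + br (br z x) y) = \<mu> (- (br x (br y z) + br y (br z x) + br z (br x y)))"
      using br_skew[of "br x y" z] br_skew[of "br y z" x] br_skew[of "br z x" y]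
      by (simp add: algebra_simps)
    then have "\<mu> (br (br x y) z + br (br y z) x + br (br z x) y) = 0"
      by (simp add: jacobi \<mu>.zero)
    then show ?thesis by (simp add: ce_diff_def \<mu>.add)
  qed
  show ?thesis
    unfolding symplectic_form_def skew_form_def closed_form_def using b s c assms(2) by blast
qed

text \<open>
  In the closedness identity for \<open>x, y\<close> in the ideal and arbitrary \<open>z\<close>, the two terms with a bracket
  containing \<open>z\<close> pair two elements of the ideal.
\<close>

lemma (in lie_algebra) isotropic_ideal_abelian:
  assumes w: "symplectic_form br w" and I: "lie_ideal br I"
    and iso: "\<And>x y. x \<in> I \<Longrightarrow> y \<in> I \<Longrightarrow> w x y = 0"
    and xy: "x \<in> I" "y \<in> I"
  shows "br x y = 0"
proof -
  have "w (br x y) z = 0" for z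
  proof -
    have "br z x \<in> I" "br y z \<in> I"
      using I xy br_skew[of y z] by (auto simp: lie_ideal_def subspace_neg)
    then have "w (br y z) x = 0" "w (br z x) y = 0" using iso xy by auto
    then show ?thesis
      using w unfolding symplectic_form_def closed_form_def by (metis add.right_neutral)
  qed
  then show ?thesis using w unfolding symplectic_form_def nondegenerate_def by blast
qed

text \<open>
  Three functionals suffice because their common kernel has dimension at least \<open>6 - 3\<close>, and an
  isotropic subspace of dimension at least three is its own orthogonal.
\<close>

lemma (in lie_algebra) isotropic_ideal_lagrangian:
  fixes f g h :: "'a \<Rightarrow> real"
  assumes dim6: "dim (UNIV :: 'a set) = 6" and w: "symplectic_form br w"
    and I: "lie_ideal br I" and iso: "\<And>x y. x \<in> I \<Longrightarrow> y \<in> I \<Longrightarrow> w x y = 0"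
    and f: "linear f" "linear g" "linear h"
    and sub: "\<And>x. f x = 0 \<Longrightarrow> g x = 0 \<Longrightarrow> h x = 0 \<Longrightarrow> x \<in> I"
  shows "lagrangian_ideal br w I"
proof -
  have fin: "dim (UNIV :: 'a set) > 0" by (simp add: dim6)
  have "dim (UNIV :: 'a set) \<le> dim I + 3"
    by (rule dim_three_functionals[OF fin f]) (rule sub)
  then have big: "dim (UNIV :: 'a set) \<le> 2 * dim I" using dim6 by simp
  have "bilinear w" "nondegenerate w"
    using w unfolding symplectic_form_def skew_form_def by blast+
  moreover have "subspace I" "I \<subseteq> form_perp w I"
    using I iso by (auto simp: lie_ideal_def form_perp_def)
  ultimately have "I = form_perp w I" using big by (rule isotropic_half_dim_eq_perp[OF fin])
  then show ?thesis using I unfolding lagrangian_ideal_def by blast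
qed

section \<open>The principal element and the adjoint map it defines\<close>

text \<open>
  The case in which \<open>\<omega>\<close> does not vanish on the given Lagrangian ideal \<open>J\<close>, with a principal element
  \<open>e\<close> and a generator \<open>k\<close> of the radical of \<open>\<omega>\<close> on \<open>J\<close>.
\<close>

locale principal_lagrangian = lie_algebra br for br :: "'a::real_vector \<Rightarrow> 'a \<Rightarrow> 'a" +
  fixes \<mu> :: "'a \<Rightarrow> real" and e :: 'a and J :: "'a set"
    and \<omega> :: "'a \<Rightarrow> 'a \<Rightarrow> real" and k :: 'a
  assumes dim6: "dim (UNIV :: 'a set) = 6"
    and lin_\<mu>: "linear \<mu>"
    and nondeg: "nondegenerate (ce_diff br \<mu>)"
    and principal: "\<mu> (br e y) = - \<mu> y"
    and lag: "lagrangian_ideal br (ce_diff br \<mu>) J"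
    and symp: "symplectic_form br \<omega>"
    and k: "k \<in> J" "k \<noteq> 0"
    and k_radical: "j \<in> J \<Longrightarrow> \<omega> k j = 0"
    and radical_line: "\<lbrakk>a \<in> J; b \<in> J; \<omega> a b \<noteq> 0; x \<in> J; \<omega> a x = 0; \<omega> b x = 0\<rbrakk>
      \<Longrightarrow> \<exists>c. x = c *\<^sub>R k"
    and not_isotropic: "\<exists>a\<in>J. \<exists>b\<in>J. \<omega> a b \<noteq> 0"
begin

abbreviation "\<Omega> \<equiv> ce_diff br \<mu>"
abbreviation "E \<equiv> br e"

lemma symp_\<Omega>: "symplectic_form br \<Omega>"
  by (rule symplectic_ce_diff[OF lin_\<mu> nondeg])

lemma bil: "bilinear \<omega>" "bilinear \<Omega>"
  by (rule symplectic_formD[OF symp], rule symplectic_formD[OF symp_\<Omega>])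

lemmas form_linear [simp] =
  bil[THEN bilinear_ladd] bil[THEN bilinear_radd] bil[THEN bilinear_lmul] bil[THEN bilinear_rmul]
  bil[THEN bilinear_lneg] bil[THEN bilinear_rneg] bil[THEN bilinear_lsub] bil[THEN bilinear_rsub]
  bil[THEN bilinear_lzero] bil[THEN bilinear_rzero]

lemma \<omega>_skew: "\<omega> x y = - \<omega> y x" and \<Omega>_skew: "\<Omega> x y = - \<Omega> y x"
  by (rule symplectic_formD[OF symp], rule symplectic_formD[OF symp_\<Omega>])

lemma \<omega>_self [simp]: "\<omega> x x = 0"
  using \<omega>_skew[of x x] by simp

lemma \<omega>_closed: "\<omega> (br x y) z + \<omega> (br y z) x + \<omega> (br z x) y = 0"
  and \<Omega>_closed: "\<Omega> (br x y) z + \<Omega> (br y z) x + \<Omega> (br z x) y = 0"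
  by (rule symplectic_formD[OF symp], rule symplectic_formD[OF symp_\<Omega>])

lemma J_ideal: "lie_ideal br J" and J_perp: "x \<in> J \<longleftrightarrow> (\<forall>y\<in>J. \<Omega> x y = 0)"
  by (rule lagrangian_idealD[OF lag])+

lemma J_subspace: "subspace J" and J_br: "y \<in> J \<Longrightarrow> br x y \<in> J"
  using J_ideal by (auto simp: lie_ideal_def)

lemma J_br': "x \<in> J \<Longrightarrow> br x y \<in> J"
  using J_br[of x y] J_subspace by (subst br_skew) (simp add: subspace_neg)

lemmas J_closed [simp] = J_br J_br' J_subspace[THEN subspace_add] J_subspace[THEN subspace_diff]
  J_subspace[THEN subspace_scale] J_subspace[THEN subspace_neg] J_subspace[THEN subspace_0] k(1)

lemma J_isotropic: "x \<in> J \<Longrightarrow> y \<in> J \<Longrightarrow> \<Omega> x y = 0"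
  using J_perp[of x] by blast

lemma J_abelian: "x \<in> J \<Longrightarrow> y \<in> J \<Longrightarrow> br x y = 0"
  by (rule isotropic_ideal_abelian[OF symp_\<Omega> J_ideal J_isotropic])

lemma E_br: "E (br x y) = br (E x) y + br x (E y)"
  by (rule br_derivation)

text \<open>
  \<open>E\<close> is a derivation and \<open>\<mu> \<circ> E = - \<mu>\<close>. This identity is what pairs the eigenvalues of \<open>E\<close> into sums
  \<open>- 1\<close>.
\<close>

lemma \<Omega>_E: "\<Omega> (E x) y + \<Omega> x (E y) = - \<Omega> x y"
proof -
  have "\<mu> (br (E x) y + br x (E y)) = - \<mu> (br x y)"
    using principal[of "br x y"] by (simp only: E_br)
  then show ?thesis using lin_\<mu> by (simp add: ce_diff_def linear_add)
qed

text \<open>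
  Closedness for \<open>e, x, y\<close>. Thus \<open>E\<close> is infinitesimally symplectic for \<open>\<omega>\<close> along abelian subalgebras,
  in particular on \<open>J\<close>.
\<close>

lemma \<omega>_E: "br x y = 0 \<Longrightarrow> \<omega> (E x) y + \<omega> x (E y) = 0"
  using \<omega>_closed[of e x y] \<omega>_skew[of "br y e" x] br_skew[of y e] by simp

lemma k_radical' [simp]: "j \<in> J \<Longrightarrow> \<omega> k j = 0" "j \<in> J \<Longrightarrow> \<omega> j k = 0"
  using k_radical \<omega>_skew[of j k] by auto

lemma radicalI: "x \<in> J \<Longrightarrow> (\<And>j. j \<in> J \<Longrightarrow> \<omega> j x = 0) \<Longrightarrow> \<exists>c. x = c *\<^sub>R k"
  using not_isotropic radical_line by blast

lemma k_ideal: "\<exists>c. br x k = c *\<^sub>R k"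
proof (rule radicalI)
  fix j assume j: "j \<in> J"
  have "br k j = 0" "br j x \<in> J" using j J_abelian by auto
  moreover have "\<omega> (br j x) k = 0" using j by simp
  ultimately show "\<omega> j (br x k) = 0"
    using \<omega>_closed[of x k j] \<omega>_skew[of j "br x k"] by simp
qed simp

text \<open>
  Otherwise \<open>k\<close> would lie in the radical of \<open>\<Omega>\<close>, since all brackets with \<open>k\<close> are multiples of \<open>k\<close>.
\<close>

lemma \<mu>_k: "\<mu> k \<noteq> 0"
proof
  assume "\<mu> k = 0"
  have "\<Omega> k y = 0" for y
  proof -
    obtain c where "br y k = c *\<^sub>R k" using k_ideal by blast
    then have "br k y = (- c) *\<^sub>R k" using br_skew[of k y] by simp
    then show ?thesis using \<open>\<mu> k = 0\<close> lin_\<mu> by (simp add: ce_diff_def linear_cmul linear_neg)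
  qed
  then show False using nondeg k(2) unfolding nondegenerate_def by blast
qed

lemma E_k [simp]: "E k = - k"
proof -
  obtain c where c: "E k = c *\<^sub>R k" using k_ideal by blast
  then have "c * \<mu> k = - \<mu> k" using principal[of k] lin_\<mu> by (simp add: linear_cmul)
  then have "(c + 1) * \<mu> k = 0" by (simp add: distrib_right)
  then have "c = - 1" using \<mu>_k by (simp add: eq_neg_iff_add_eq_0)
  then show ?thesis using c by simp
qed

text \<open>
  The centraliser of \<open>k\<close>. It is also the \<open>\<Omega>\<close>-orthogonal of \<open>k\<close>, an ideal of codimension one that
  is complemented by \<open>e\<close>, so that statements about brackets reduce to brackets with \<open>N\<close> and the map \<open>E\<close>.
\<close>

definition N where "N = {x. br x k = 0}"

lemma N_iff: "x \<in> N \<longleftrightarrow> \<Omega> x k = 0"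
proof -
  obtain c where "br x k = c *\<^sub>R k" using k_ideal by blast
  then show ?thesis using \<mu>_k k(2) lin_\<mu> by (simp add: N_def ce_diff_def linear_cmul)
qed

lemma N_subspace: "subspace N"
  by (auto simp: N_def subspace_def)

lemma N_ideal: assumes "x \<in> N" shows "br y x \<in> N" "br x y \<in> N"
proof -
  obtain c where "br y k = c *\<^sub>R k" using k_ideal by blast
  then have "br (br y x) k = 0"
    using br_derivation[of y x k] assms by (simp add: N_def)
  then show "br y x \<in> N" by (simp add: N_def)
  moreover have "br x y = - br y x" by (rule br_skew)
  ultimately show "br x y \<in> N" by (simp only: N_def mem_Collect_eq br_linear) simp
qed

lemmas N_closed [simp] = N_ideal N_subspace[THEN subspace_add] N_subspace[THEN subspace_diff]
  N_subspace[THEN subspace_scale] N_subspace[THEN subspace_neg] N_subspace[THEN subspace_0]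

lemma J_N [simp]: "x \<in> J \<Longrightarrow> x \<in> N"
  by (simp add: N_def J_abelian)

lemma N_k [simp]: "x \<in> N \<Longrightarrow> br x k = 0" "x \<in> N \<Longrightarrow> br k x = 0"
  using br_skew[of k x] by (simp_all add: N_def)

lemma split_e: obtains c y where "y \<in> N" "x = c *\<^sub>R e + y"
proof -
  obtain c where c: "br x k = c *\<^sub>R k" using k_ideal by blast
  show ?thesis
    by (rule that[where c = "- c" and y = "x + c *\<^sub>R e"]) (simp_all add: N_def c del: N_k)
qed

text \<open>
  On the plane \<open>J/\<real>k\<close> the map \<open>E\<close> preserves a nonzero area form infinitesimally, so it is traceless and
  squares to a scalar by the Cayley-Hamilton theorem, namely to minus its determinant.
\<close>

lemma E_square_J: "\<exists>m. \<forall>j\<in>J. \<exists>c. E (E j) - m *\<^sub>R j = c *\<^sub>R k"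
proof -
  obtain u v where uv: "u \<in> J" "v \<in> J" "\<omega> u v \<noteq> 0" using not_isotropic by blast
  have inv: "\<omega> (E x) y + \<omega> x (E y) = 0" if "x \<in> J" "y \<in> J" for x y
    using \<omega>_E J_abelian that by blast
  define D where "D = \<omega> (E u) (E v)"
  have uu: "\<omega> (E (E u)) v = - D" "\<omega> (E (E v)) u = D" "\<omega> (E (E u)) u = 0" "\<omega> (E (E v)) v = 0"
    using inv[of "E u" v, OF J_br[OF uv(1)] uv(2)] inv[of "E v" u, OF J_br[OF uv(2)] uv(1)]
      inv[of "E u" u, OF J_br[OF uv(1)] uv(1)] inv[of "E v" v, OF J_br[OF uv(2)] uv(2)]
      \<omega>_skew[of "E v" "E u"] \<omega>_self[of "E u"] \<omega>_self[of "E v"] unfolding D_def by linarith+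
  have uu': "\<omega> u (E (E v)) = - D" "\<omega> v (E (E u)) = D" "\<omega> u (E (E u)) = 0" "\<omega> v (E (E v)) = 0"
    using uu \<omega>_skew[of u "E (E u)"] \<omega>_skew[of u "E (E v)"] \<omega>_skew[of v "E (E u)"]
      \<omega>_skew[of v "E (E v)"] by linarith+
  have vu: "\<omega> v u = - \<omega> u v" by (rule \<omega>_skew)
  \<comment> \<open>On the plane, \<open>\<omega> (E u) (E v)\<close> is the determinant of \<open>E\<close> times \<open>\<omega> u v\<close>.\<close>
  define m where "m = - D / \<omega> u v"
  have "\<exists>c. E (E j) - m *\<^sub>R j = c *\<^sub>R k" if j: "j \<in> J" for j
  proof -
    define s t where "s = \<omega> j v / \<omega> u v" and "t = \<omega> u j / \<omega> u v"
    have "\<exists>c. j - s *\<^sub>R u - t *\<^sub>R v = c *\<^sub>R k"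
      by (rule radical_line[OF uv])
        (use uv j \<omega>_skew[of v u] \<omega>_skew[of v j] in \<open>auto simp: s_def t_def\<close>)
    then obtain c where "j - s *\<^sub>R u - t *\<^sub>R v = c *\<^sub>R k" ..
    then have jj: "j = s *\<^sub>R u + t *\<^sub>R v + c *\<^sub>R k" by (simp add: algebra_simps)
    show ?thesis
    proof (rule radical_line[OF uv])
      show "E (E j) - m *\<^sub>R j \<in> J" using j by simp
      show "\<omega> u (E (E j) - m *\<^sub>R j) = 0" "\<omega> v (E (E j) - m *\<^sub>R j) = 0"
        using uv by (simp_all add: jj m_def uu' vu)
    qed
  qed
  then show ?thesis by blast
qed

text \<open>
  The pairing \<open>\<Omega>\<close> identifies \<open>N/J\<close> with the dual of \<open>J/\<real>k\<close>, and turns \<open>E\<close> into minus the transpose of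
  \<open>E + 1\<close>. Hence \<open>(E + 1)\<^sup>2 = m\<close> modulo \<open>J\<close> on \<open>N\<close>.
\<close>

lemma F_square_N:
  assumes m: "\<forall>j\<in>J. \<exists>c. E (E j) - m *\<^sub>R j = c *\<^sub>R k" and x: "x \<in> N"
  shows "E (E x) + 2 *\<^sub>R E x + x - m *\<^sub>R x \<in> J"
proof (rule J_perp[THEN iffD2], rule ballI)
  fix j assume j: "j \<in> J"
  obtain c where "E (E j) - m *\<^sub>R j = c *\<^sub>R k" using m j by blast
  then have c: "E (E j) = m *\<^sub>R j + c *\<^sub>R k" by (simp add: algebra_simps)
  have "\<Omega> x (E (E j)) = m * \<Omega> x j" using x by (simp add: c N_iff)
  then show "\<Omega> (E (E x) + 2 *\<^sub>R E x + x - m *\<^sub>R x) j = 0"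
    using \<Omega>_E[of "E x" j] \<Omega>_E[of x "E j"] \<Omega>_E[of x j]
    by (simp only: form_linear real_scaleR_def)
qed

end

context principal_lagrangian
begin

lemma lie_idealI:
  assumes "subspace I" "\<And>x. x \<in> I \<Longrightarrow> E x \<in> I"
    and "\<And>x y. x \<in> I \<Longrightarrow> y \<in> N \<Longrightarrow> br y x \<in> I"
  shows "lie_ideal br I"
  unfolding lie_ideal_def
proof (intro conjI allI ballI)
  fix z x assume x: "x \<in> I"
  obtain c y where "y \<in> N" "z = c *\<^sub>R e + y" by (rule split_e)
  then show "br z x \<in> I"
    using assms x by (simp add: subspace_add subspace_scale)
qed (rule assms)

lemma \<omega>_E_J: "x \<in> J \<Longrightarrow> y \<in> J \<Longrightarrow> \<omega> (E x) y + \<omega> x (E y) = 0"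
  by (rule \<omega>_E) (rule J_abelian)

lemma \<Omega>_N_k [simp]: "x \<in> N \<Longrightarrow> \<Omega> x k = 0" "x \<in> N \<Longrightarrow> \<Omega> k x = 0"
  using \<Omega>_skew[of k x] by (simp_all add: N_iff)

text \<open>
  The image of \<open>E - r\<close> on \<open>J/\<real>k\<close> consists of eigenvectors for \<open>- r\<close>. It is not zero: a
  scalar map that preserves a nonzero area form infinitesimally is zero, whereas \<open>r > 0\<close>.
\<close>

lemma ex_eigenvector:
  assumes m: "\<forall>j\<in>J. \<exists>c. E (E j) - (r * r) *\<^sub>R j = c *\<^sub>R k" and r: "r > 0"
  obtains u v a where "u \<in> J" "v \<in> J" "\<omega> u v \<noteq> 0" "E u = - r *\<^sub>R u + a *\<^sub>R k"
proof -
  have "\<exists>w\<in>J. \<exists>v\<in>J. \<omega> (E w - r *\<^sub>R w) v \<noteq> 0"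
  proof (rule ccontr)
    assume "\<not> ?thesis"
    then have eig: "\<omega> (E w) v = r * \<omega> w v" if "w \<in> J" "v \<in> J" for w v
      using that by force
    obtain a b where ab: "a \<in> J" "b \<in> J" "\<omega> a b \<noteq> 0" using not_isotropic by blast
    have "\<omega> (E a) b = r * \<omega> a b" "\<omega> (E b) a = r * \<omega> b a" using eig ab by blast+
    moreover have "\<omega> a (E b) = - \<omega> (E b) a" "\<omega> b a = - \<omega> a b" by (rule \<omega>_skew)+
    ultimately have "2 * r * \<omega> a b = 0" using \<omega>_E_J[OF ab(1,2)] by simp
    then show False using ab(3) r by simp
  qed
  then obtain w v where w: "w \<in> J" "v \<in> J" "\<omega> (E w - r *\<^sub>R w) v \<noteq> 0" by blast
  obtain c where "E (E w) - (r * r) *\<^sub>R w = c *\<^sub>R k" using m w(1) by blast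
  then have "E (E w) = (r * r) *\<^sub>R w + c *\<^sub>R k" by (simp add: algebra_simps)
  then have "E (E w - r *\<^sub>R w) = - r *\<^sub>R (E w - r *\<^sub>R w) + c *\<^sub>R k"
    by (simp add: algebra_simps)
  then show ?thesis by (rule that[OF _ w(2,3), rotated]) (use w(1) in simp)
qed

end

section \<open>Real eigenvalues on the Lagrangian ideal\<close>

text \<open>
  The case \<open>m = r\<^sup>2\<close> with \<open>r > 0\<close>, where \<open>u\<close> spans the eigenline of \<open>E\<close> on \<open>J/\<real>k\<close> for \<open>- r\<close>.
\<close>

locale real_spectrum = principal_lagrangian br \<mu> e J \<omega> k
  for br :: "'a::real_vector \<Rightarrow> 'a \<Rightarrow> 'a" and \<mu> e J \<omega> k +
  fixes r :: real and u v :: 'a and \<alpha> :: real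
  assumes r: "r > 0"
    and E_square: "\<forall>j\<in>J. \<exists>c. E (E j) - (r * r) *\<^sub>R j = c *\<^sub>R k"
    and u: "u \<in> J" and v: "v \<in> J" and uv: "\<omega> u v \<noteq> 0"
    and E_u: "E u = - r *\<^sub>R u + \<alpha> *\<^sub>R k"
begin

lemma span_u_k:
  assumes x: "x \<in> J" "\<omega> u x = 0"
  obtains s t where "x = s *\<^sub>R u + t *\<^sub>R k"
proof -
  define s where "s = \<omega> v x / \<omega> v u"
  have vu: "\<omega> v u \<noteq> 0" using uv \<omega>_skew[of v u] by simp
  have "\<exists>c. x - s *\<^sub>R u = c *\<^sub>R k"
    by (rule radical_line[OF u v uv]) (use x u vu in \<open>simp_all add: s_def\<close>)
  then obtain c where "x - s *\<^sub>R u = c *\<^sub>R k" ..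
  then have "x = s *\<^sub>R u + c *\<^sub>R k" by (simp add: algebra_simps)
  then show ?thesis by (rule that)
qed

lemma \<omega>_u_E: "j \<in> J \<Longrightarrow> \<omega> u (E j) = r * \<omega> u j"
  using \<omega>_E_J[OF u, of j] by (simp add: E_u)

text \<open>
  As a function of \<open>x\<close>, the left-hand side scales by \<open>2 r\<close> under \<open>E\<close> and vanishes on \<open>J\<close>, but
  \<open>2 r\<close> is not one of the eigenvalues \<open>- 1 \<plusminus> r\<close> of \<open>E\<close> on \<open>N/J\<close>. The consequence is that the plane
  spanned by \<open>u\<close> and \<open>k\<close> is an ideal.
\<close>

lemma \<omega>_u_br_u:
  assumes x: "x \<in> N" shows "\<omega> u (br x u) = 0"
proof -
  define \<theta> where "\<theta> y = \<omega> u (br y u)" for y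
  have step: "\<theta> (E y) = 2 * r * \<theta> y" if "y \<in> N" for y
  proof -
    have "br (E y) u = E (br y u) - br y (E u)"
      by (simp only: E_br[of y u] add_diff_cancel_right')
    also have "br y (E u) = - r *\<^sub>R br y u" using that by (simp add: E_u)
    finally show ?thesis using \<omega>_u_E[of "br y u"] u by (simp add: \<theta>_def)
  qed
  have "E (E x) + 2 *\<^sub>R E x + x - (r * r) *\<^sub>R x \<in> J" by (rule F_square_N[OF E_square x])
  then have "br (E (E x) + 2 *\<^sub>R E x + x - (r * r) *\<^sub>R x) u = 0"
    using u by (rule J_abelian)
  then have "\<theta> (E (E x) + 2 *\<^sub>R E x + x - (r * r) *\<^sub>R x) = 0"
    by (simp only: \<theta>_def bilinear_rzero[OF bil(1)])
  then have "\<theta> (E (E x)) + 2 * \<theta> (E x) + \<theta> x - r * r * \<theta> x = 0"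
    by (simp add: \<theta>_def)
  then have "(3 * (r * r) + 4 * r + 1) * \<theta> x = 0"
    using step[of "E x"] step[of x] x by (simp add: algebra_simps)
  moreover have "3 * (r * r) + 4 * r + 1 > 0" using r by (simp add: add_pos_pos)
  ultimately show ?thesis by (simp add: \<theta>_def)
qed

lemma br_u: assumes "x \<in> N" obtains s t where "br x u = s *\<^sub>R u + t *\<^sub>R k"
  using span_u_k[of "br x u"] \<omega>_u_br_u[OF assms] u by auto

text \<open>
  The space with eigenvalues \<open>- 1, - r, - 1 - r\<close>. On the \<open>\<Omega>\<close>-orthogonal of \<open>u\<close> and \<open>k\<close> the map
  \<open>E + 1 + r\<close> takes values in \<open>J\<close>; the last condition forces them into the span of \<open>u\<close> and \<open>k\<close>.
\<close>

definition I where "I = {x \<in> N. \<Omega> x u = 0 \<and> \<omega> u (E x + (1 + r) *\<^sub>R x) = 0}"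

lemma linear_\<Omega>_left: "linear (\<lambda>x. \<Omega> x z)"
  by (rule bilinear_linear_left[OF bil(2)])

lemma linear_shift: "linear (\<lambda>x. \<omega> u (E x + (1 + r) *\<^sub>R x))"
  by (rule linearI) (simp_all add: algebra_simps)

lemma subspace_I: "subspace I"
proof -
  have "I = {x \<in> {x \<in> N. \<Omega> x u = 0}. \<omega> u (E x + (1 + r) *\<^sub>R x) = 0}"
    unfolding I_def by blast
  then show ?thesis
    using subspace_kernel_functional[OF subspace_kernel_functional[OF N_subspace linear_\<Omega>_left] linear_shift]
    by simp
qed

text \<open>
  By the pairing, \<open>E + 1 + r\<close> is adjoint to \<open>r - E\<close>, which maps \<open>J\<close> into the span of \<open>u\<close> and \<open>k\<close>.
\<close>

lemma shift_J:
  assumes x: "x \<in> N" "\<Omega> x u = 0" shows "E x + (1 + r) *\<^sub>R x \<in> J"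
proof (rule J_perp[THEN iffD2], rule ballI)
  fix j assume j: "j \<in> J"
  have "\<omega> u (E j - r *\<^sub>R j) = 0" using \<omega>_u_E[OF j] by simp
  then obtain s t where "E j - r *\<^sub>R j = s *\<^sub>R u + t *\<^sub>R k"
    using span_u_k[of "E j - r *\<^sub>R j"] j by auto
  then have "E j = r *\<^sub>R j + s *\<^sub>R u + t *\<^sub>R k" by (simp add: algebra_simps)
  then have "\<Omega> x (E j) = r * \<Omega> x j" using x by simp
  then show "\<Omega> (E x + (1 + r) *\<^sub>R x) j = 0"
    using \<Omega>_E[of x j] by (simp add: algebra_simps)
qed

lemma I_N: "x \<in> I \<Longrightarrow> x \<in> N" and I_\<Omega>_u: "x \<in> I \<Longrightarrow> \<Omega> x u = 0" "x \<in> I \<Longrightarrow> \<Omega> u x = 0"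
  using \<Omega>_skew[of u x] by (auto simp: I_def)

lemma I_E:
  assumes "x \<in> I" obtains s t where "E x = - (1 + r) *\<^sub>R x + s *\<^sub>R u + t *\<^sub>R k"
proof -
  have "E x + (1 + r) *\<^sub>R x \<in> J" "\<omega> u (E x + (1 + r) *\<^sub>R x) = 0"
    using assms shift_J by (auto simp: I_def)
  then obtain s t where "E x + (1 + r) *\<^sub>R x = s *\<^sub>R u + t *\<^sub>R k" by (rule span_u_k)
  then have "E x = - (1 + r) *\<^sub>R x + s *\<^sub>R u + t *\<^sub>R k" by (simp add: algebra_simps)
  then show ?thesis by (rule that)
qed

lemma u_I: "u \<in> I" and k_I: "k \<in> I"
  using u J_isotropic by (simp_all add: I_def E_u)

text \<open>
  The bracket lies in the span of \<open>u\<close> and \<open>k\<close>, where \<open>E\<close> has eigenvalues \<open>- r\<close> and \<open>- 1\<close>, but is itself an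
  eigenvector for the sum \<open>(- 1 - r) + (- r)\<close>.
\<close>

lemma I_br_u: assumes x: "x \<in> I" shows "br x u = 0"
proof -
  obtain s t where st: "br x u = s *\<^sub>R u + t *\<^sub>R k" using br_u[OF I_N[OF x]] .
  obtain p q where E_x: "E x = - (1 + r) *\<^sub>R x + p *\<^sub>R u + q *\<^sub>R k" using I_E[OF x] .
  have "E (br x u) = br (E x) u + br x (E u)" by (rule E_br)
  also have "\<dots> = - (1 + r) *\<^sub>R br x u + - r *\<^sub>R br x u"
    using u I_N[OF x] by (simp add: E_x E_u br_self)
  also have "\<dots> = - (1 + 2 * r) *\<^sub>R br x u"
    by (subst scaleR_add_left[symmetric]) simp
  finally have eq: "E (s *\<^sub>R u + t *\<^sub>R k) = - (1 + 2 * r) *\<^sub>R (s *\<^sub>R u + t *\<^sub>R k)"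
    unfolding st .
  have vu: "\<omega> v u \<noteq> 0" using uv \<omega>_skew[of v u] by simp
  have lhs: "\<omega> v (E (s *\<^sub>R u + t *\<^sub>R k)) = - r * s * \<omega> v u" using v by (simp add: E_u)
  have rhs: "\<omega> v (- (1 + 2 * r) *\<^sub>R (s *\<^sub>R u + t *\<^sub>R k)) = - (1 + 2 * r) * s * \<omega> v u"
    using v by (simp add: algebra_simps)
  have "- r * s * \<omega> v u = - (1 + 2 * r) * s * \<omega> v u"
    by (rule trans[OF lhs[unfolded eq, symmetric] rhs])
  then have "(1 + r) * s * \<omega> v u = 0" by (simp add: algebra_simps)
  then have s: "s = 0" using vu r by simp
  have "(2 * r * t) *\<^sub>R k = 0" using eq by (simp add: s algebra_simps)
  then have "t = 0" using k(2) r by simp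
  then show ?thesis using s st by simp
qed

text \<open>
  The main point is the vanishing of the functional \<open>\<tau>\<close> below. It scales by
  \<open>1 + 2 r\<close> under \<open>E\<close>, which is neither an eigenvalue \<open>\<plusminus> r\<close> of \<open>E\<close> on \<open>J/\<real>k\<close> nor an eigenvalue
  \<open>- 1 \<plusminus> r\<close> on \<open>N/J\<close>, so that \<open>\<tau>\<close> vanishes on \<open>J\<close> first and then on \<open>N\<close>.
\<close>

lemma N_br_I:
  assumes x: "x \<in> I" and y: "y \<in> N" shows "br y x \<in> I"
proof -
  note xN = I_N[OF x]
  obtain p q where E_x: "E x = - (1 + r) *\<^sub>R x + p *\<^sub>R u + q *\<^sub>R k" using I_E[OF x] .
  have \<Omega>u: "\<Omega> (br y x) u = 0" if y: "y \<in> N" for y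
  proof -
    obtain s t where "br y u = s *\<^sub>R u + t *\<^sub>R k" using br_u[OF y] .
    then have "br u y = - (s *\<^sub>R u + t *\<^sub>R k)" using br_skew[of u y] by simp
    then have "\<Omega> (br u y) x = 0" using I_\<Omega>_u[OF x] xN by simp
    then show ?thesis using \<Omega>_closed[of y x u] I_br_u[OF x] by simp
  qed
  have shift: "E (br y x) + (1 + r) *\<^sub>R br y x = br (E y) x + p *\<^sub>R br y u" if "y \<in> N" for y
    unfolding E_br E_x using that by (simp add: algebra_simps)
  define \<tau> where "\<tau> y = \<omega> u (br (E y) x)" for y
  have in_J: "br (E y) x \<in> J" if y: "y \<in> N" for y
  proof -
    have "br (E y) x + p *\<^sub>R br y u \<in> J"
      using shift_J[of "br y x"] \<Omega>u[OF y] y unfolding shift[OF y] by simp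
    moreover have "p *\<^sub>R br y u \<in> J" using u by simp
    ultimately show ?thesis using subspace_diff[OF J_subspace] by fastforce
  qed
  have step: "\<tau> (E y) = (1 + 2 * r) * \<tau> y" if y: "y \<in> N" for y
  proof -
    have "br (E (E y)) x = E (br (E y) x) - br (E y) (E x)"
      by (simp only: E_br[of "E y" x] add_diff_cancel_right')
    also have "br (E y) (E x) = - (1 + r) *\<^sub>R br (E y) x + p *\<^sub>R br (E y) u"
      unfolding E_x using y by simp
    finally have eq: "br (E (E y)) x = E (br (E y) x) - (- (1 + r) *\<^sub>R br (E y) x + p *\<^sub>R br (E y) u)" .
    have "\<tau> (E y) = \<omega> u (E (br (E y) x)) + (1 + r) * \<tau> y"
      unfolding \<tau>_def eq using \<omega>_u_br_u[of "E y"] y by (simp add: algebra_simps)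
    then show ?thesis using \<omega>_u_E[OF in_J[OF y]] by (simp add: \<tau>_def algebra_simps)
  qed
  have \<tau>_J: "\<tau> j = 0" if j: "j \<in> J" for j
  proof -
    obtain c where "E (E j) - (r * r) *\<^sub>R j = c *\<^sub>R k" using E_square j by blast
    then have "E (E j) = (r * r) *\<^sub>R j + c *\<^sub>R k" by (simp add: algebra_simps)
    then have "\<tau> (E (E j)) = r * r * \<tau> j" using xN by (simp add: \<tau>_def)
    then have "((1 + 2 * r) * (1 + 2 * r) - r * r) * \<tau> j = 0"
      using step[of "E j"] step[of j] j by (simp add: algebra_simps)
    moreover have "(1 + 2 * r) * (1 + 2 * r) - r * r = 3 * (r * r) + 4 * r + 1"
      by (simp add: algebra_simps)
    moreover have "3 * (r * r) + 4 * r + 1 > 0" using r by (simp add: add_pos_pos)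
    ultimately show ?thesis by simp
  qed
  have "\<tau> (E (E y) + 2 *\<^sub>R E y + y - (r * r) *\<^sub>R y) = 0"
    by (rule \<tau>_J[OF F_square_N[OF E_square y]])
  then have "\<tau> (E (E y)) + 2 * \<tau> (E y) + \<tau> y - r * r * \<tau> y = 0"
    by (simp add: \<tau>_def)
  then have "(3 * (r * r) + 8 * r + 4) * \<tau> y = 0"
    using step[of "E y"] step[of y] y by (simp add: algebra_simps)
  moreover have "3 * (r * r) + 8 * r + 4 > 0" using r by (simp add: add_pos_pos)
  ultimately have "\<tau> y = 0" by simp
  then have "\<omega> u (E (br y x) + (1 + r) *\<^sub>R br y x) = 0"
    unfolding shift[OF y] using \<omega>_u_br_u[OF y] by (simp add: \<tau>_def)
  then show ?thesis using \<Omega>u[OF y] y by (simp add: I_def)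
qed

lemma I_ideal: "lie_ideal br I"
proof (rule lie_idealI[OF subspace_I])
  fix x assume x: "x \<in> I"
  obtain s t where "E x = - (1 + r) *\<^sub>R x + s *\<^sub>R u + t *\<^sub>R k" using I_E[OF x] .
  then show "E x \<in> I"
    using x u_I k_I by (simp only:) (intro subspace_add[OF subspace_I] subspace_scale[OF subspace_I])
qed (rule N_br_I)

lemma I_abelian: assumes x: "x \<in> I" and y: "y \<in> I" shows "br x y = 0"
proof (rule isotropic_ideal_abelian[OF symp_\<Omega> I_ideal _ x y])
  fix x y assume x: "x \<in> I" and y: "y \<in> I"
  obtain s t where E_x: "E x = - (1 + r) *\<^sub>R x + s *\<^sub>R u + t *\<^sub>R k" using I_E[OF x] .
  obtain p q where E_y: "E y = - (1 + r) *\<^sub>R y + p *\<^sub>R u + q *\<^sub>R k" using I_E[OF y] .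
  have "(1 + 2 * r) * \<Omega> x y = 0"
    using \<Omega>_E[of x y] I_\<Omega>_u[OF x] I_\<Omega>_u[OF y] I_N[OF x] I_N[OF y]
    by (simp add: E_x E_y algebra_simps)
  then show "\<Omega> x y = 0" using r by simp
qed

text \<open>
  The identity for commuting elements has to be used along the flag \<open>k, u, x\<close>, because \<open>E\<close> is only
  triangular on \<open>I\<close>.
\<close>

lemma I_isotropic: assumes x: "x \<in> I" and y: "y \<in> I" shows "\<omega> x y = 0"
proof -
  have \<omega>k: "\<omega> k x = 0" if x: "x \<in> I" for x
  proof -
    obtain s t where E_x: "E x = - (1 + r) *\<^sub>R x + s *\<^sub>R u + t *\<^sub>R k" using I_E[OF x] .
    have "(2 + r) * \<omega> k x = 0"
      using \<omega>_E[OF I_abelian[OF k_I x]] u by (simp add: E_x algebra_simps)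
    then show ?thesis using r by simp
  qed
  have \<omega>u: "\<omega> u x = 0" if x: "x \<in> I" for x
  proof -
    obtain s t where E_x: "E x = - (1 + r) *\<^sub>R x + s *\<^sub>R u + t *\<^sub>R k" using I_E[OF x] .
    have "(1 + 2 * r) * \<omega> u x = 0"
      using \<omega>_E[OF I_abelian[OF u_I x]] u \<omega>k[OF x] by (simp add: E_x E_u algebra_simps)
    then show ?thesis using r by simp
  qed
  obtain s t where E_x: "E x = - (1 + r) *\<^sub>R x + s *\<^sub>R u + t *\<^sub>R k" using I_E[OF x] .
  obtain p q where E_y: "E y = - (1 + r) *\<^sub>R y + p *\<^sub>R u + q *\<^sub>R k" using I_E[OF y] .
  have "\<omega> x k = 0" "\<omega> x u = 0" using \<omega>k[OF x] \<omega>u[OF x] \<omega>_skew[of x k] \<omega>_skew[of x u] by simp_all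
  then have "(2 + 2 * r) * \<omega> x y = 0"
    using \<omega>_E[OF I_abelian[OF x y]] \<omega>k[OF y] \<omega>u[OF y] by (simp add: E_x E_y algebra_simps)
  then show ?thesis using r by simp
qed

lemma lagrangian_I: "lagrangian_ideal br \<omega> I"
proof (rule isotropic_ideal_lagrangian[OF dim6 symp I_ideal I_isotropic
      linear_\<Omega>_left linear_\<Omega>_left linear_shift])
  fix x assume "\<Omega> x k = 0" "\<Omega> x u = 0" "\<omega> u (E x + (1 + r) *\<^sub>R x) = 0"
  then show "x \<in> I" unfolding I_def N_iff by blast
qed

end

section \<open>Purely imaginary or zero eigenvalues on the Lagrangian ideal\<close>

text \<open>
  The two recurrences have characteristic polynomials \<open>(X + 1)\<^sup>2 - m\<close> and \<open>X\<^sup>2 (X\<^sup>2 - 4 m)\<close>, which have a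
  common root only for \<open>m = 1\<close> and \<open>m = 1/9\<close>.
\<close>

lemma recurrence_vanishes:
  fixes P :: "nat \<Rightarrow> real"
  assumes m: "m \<le> 0"
    and rec: "\<And>n. P (n + 2) = - 2 * P (n + 1) + (m - 1) * P n"
    and four: "\<And>n. P (n + 4) = 4 * m * P (n + 2)"
  shows "P 0 = 0"
proof -
  have lin: "4 * P (n + 1) = 3 * (m - 1) * P n" for n
  proof -
    have eqs: "P (n + 2) = - 2 * P (n + 1) + (m - 1) * P n"
      "P (n + 3) = - 2 * P (n + 2) + (m - 1) * P (n + 1)"
      "P (n + 4) = - 2 * P (n + 3) + (m - 1) * P (n + 2)"
      using rec[of n] rec[of "n + 1"] rec[of "n + 2"] by (simp_all add: eval_nat_numeral)
    have "(m - 1) * (4 * P (n + 1) - 3 * (m - 1) * P n) = 0"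
      using four[of n] unfolding eqs by (simp add: algebra_simps)
    then show ?thesis using m by simp
  qed
  have "4 * (4 * P 2) = 3 * (m - 1) * (4 * P 1)" using lin[of 1] by (simp add: numeral_2_eq_2)
  also have "4 * P 1 = 3 * (m - 1) * P 0" using lin[of 0] by simp
  finally have "4 * (4 * P 2) = 3 * (m - 1) * (3 * (m - 1) * P 0)" .
  moreover have "P 2 = - 2 * P 1 + (m - 1) * P 0" using rec[of 0] by (simp add: numeral_2_eq_2)
  ultimately have "(m - 1) * (9 * m - 1) * P 0 = 0"
    using lin[of 0] by (simp add: algebra_simps)
  then show ?thesis using m by auto
qed

text \<open>
  The case \<open>m \<le> 0\<close>, in which \<open>E\<close> has eigenvalues of real part zero on \<open>J/\<real>k\<close> and of real part
  \<open>- 1\<close> on \<open>N/J\<close>.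
\<close>

locale imaginary_spectrum = principal_lagrangian br \<mu> e J \<omega> k
  for br :: "'a::real_vector \<Rightarrow> 'a \<Rightarrow> 'a" and \<mu> e J \<omega> k +
  fixes m :: real and u v :: 'a
  assumes m: "m \<le> 0"
    and E_square: "\<forall>j\<in>J. \<exists>c. E (E j) - m *\<^sub>R j = c *\<^sub>R k"
    and u: "u \<in> J" and v: "v \<in> J" and uv: "\<omega> u v \<noteq> 0"
begin

lemma E_E_J: assumes "j \<in> J" obtains c where "E (E j) = m *\<^sub>R j + c *\<^sub>R k"
proof -
  obtain c where "E (E j) - m *\<^sub>R j = c *\<^sub>R k" using E_square assms by blast
  then have "E (E j) = m *\<^sub>R j + c *\<^sub>R k" by (simp add: algebra_simps)
  then show ?thesis by (rule that)
qed

text \<open>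
  \<open>N\<close> acts trivially on \<open>J/\<real>k\<close>: this action shifts real parts of eigenvalues by \<open>- 1\<close>, and they are all
  zero on \<open>J/\<real>k\<close>. In real terms, the values of the functional along the orbit of \<open>x\<close> under \<open>E\<close> satisfy one
  recurrence from the action of \<open>E\<close> on \<open>N/J\<close> and one from its action on pairs of elements of \<open>J/\<real>k\<close>.
\<close>

lemma \<omega>_J_br_J:
  assumes x: "x \<in> N" and ab: "a \<in> J" "b \<in> J" shows "\<omega> a (br x b) = 0"
proof -
  define T where "T a b y = \<omega> a (br y b)" for a b y
  have T_E: "T a b (E y) = - T (E a) b y - T a (E b) y" if "a \<in> J" "b \<in> J" for a b y
  proof -
    have "br (E y) b = E (br y b) - br y (E b)" by (simp only: E_br[of y b] add_diff_cancel_right')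
    then have "T a b (E y) = \<omega> a (E (br y b)) - T a (E b) y" by (simp add: T_def)
    then show ?thesis using \<omega>_E_J[of a "br y b"] that by (simp add: T_def)
  qed
  have T_left: "T (E (E a)) b y = m * T a b y" if J: "a \<in> J" "b \<in> J" for a b y
  proof -
    obtain c where c: "E (E a) = m *\<^sub>R a + c *\<^sub>R k" using E_E_J[OF J(1)] .
    show ?thesis unfolding T_def c using J by simp
  qed
  have T_right: "T a (E (E b)) y = m * T a b y" if J: "a \<in> J" "b \<in> J" "y \<in> N" for a b y
  proof -
    obtain c where c: "E (E b) = m *\<^sub>R b + c *\<^sub>R k" using E_E_J[OF J(2)] .
    show ?thesis unfolding T_def c using J by simp
  qed
  have T_E2: "T a b (E (E y)) = 2 * m * T a b y + 2 * T (E a) (E b) y"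
    if "a \<in> J" "b \<in> J" "y \<in> N" for a b y
    using T_E[of a b "E y"] T_E[of "E a" b y] T_E[of a "E b" y] T_left[of a b y] T_right[of a b y]
      that by simp
  have T_E4: "T a b (E (E (E (E y)))) = 4 * m * T a b (E (E y))" if y: "y \<in> N" for y
    using T_E2[of a b "E (E y)"] T_E2[of a b y] T_E2[of "E a" "E b" y]
      T_left[of a "E (E b)" y] T_right[of a b y] ab y by (simp add: algebra_simps)
  have T_rec: "T a b (E (E y)) = - 2 * T a b (E y) + (m - 1) * T a b y" if y: "y \<in> N" for y
  proof -
    have "br (E (E y) + 2 *\<^sub>R E y + y - m *\<^sub>R y) b = 0"
      using F_square_N[OF E_square y] ab(2) by (rule J_abelian)
    then have "T a b (E (E y) + 2 *\<^sub>R E y + y - m *\<^sub>R y) = 0"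
      by (simp only: T_def bilinear_rzero[OF bil(1)])
    then show ?thesis by (simp add: T_def algebra_simps)
  qed
  define P where "P n = T a b ((E ^^ n) x)" for n
  have N: "(E ^^ n) x \<in> N" for n by (induction n) (use x in simp_all)
  have "P (n + 2) = - 2 * P (n + 1) + (m - 1) * P n" "P (n + 4) = 4 * m * P (n + 2)" for n
    using T_rec[OF N[of n]] T_E4[OF N[of n]] by (simp_all add: P_def eval_nat_numeral)
  then have "P 0 = 0" by (rule recurrence_vanishes[OF m])
  then show ?thesis by (simp add: P_def T_def)
qed

lemma br_N_J:
  assumes "x \<in> N" "j \<in> J" obtains c where "br x j = c *\<^sub>R k" "br j x = - c *\<^sub>R k"
proof -
  obtain c where c: "br x j = c *\<^sub>R k"
    using radicalI[of "br x j"] \<omega>_J_br_J[OF assms(1) _ assms(2)] assms by auto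
  moreover have "br j x = - c *\<^sub>R k" using c br_skew[of j x] by simp
  ultimately show ?thesis by (rule that)
qed

definition R where "R x = E (E x) + 2 *\<^sub>R E x + x - m *\<^sub>R x"

lemma linear_R: "linear R"
  unfolding R_def by (rule linearI) (simp_all add: algebra_simps)

lemma R_J: "x \<in> N \<Longrightarrow> R x \<in> J"
  unfolding R_def by (rule F_square_N[OF E_square])

text \<open>
  The elements \<open>x\<close> of \<open>N\<close> with \<open>R x\<close> in the line \<open>\<real>k\<close>, where \<open>R = (E + 1)\<^sup>2 - m\<close>. This is the space on which
  all eigenvalues of \<open>E\<close> have real part \<open>- 1\<close>.
\<close>

definition I where "I = {x \<in> N. \<omega> u (R x) = 0 \<and> \<omega> v (R x) = 0}"

lemma I_N: "x \<in> I \<Longrightarrow> x \<in> N" by (simp add: I_def)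

lemma linear_\<omega>_R: "linear (\<lambda>x. \<omega> z (R x))"
  using linear_compose[OF linear_R bilinear_linear_right[OF bil(1)]] by (simp add: o_def)

lemma subspace_I: "subspace I"
proof -
  have "I = {x \<in> {x \<in> N. \<omega> u (R x) = 0}. \<omega> v (R x) = 0}"
    unfolding I_def by blast
  then show ?thesis
    using subspace_kernel_functional[OF subspace_kernel_functional[OF N_subspace linear_\<omega>_R] linear_\<omega>_R]
    by simp
qed

lemma I_R: assumes "x \<in> I" obtains c where "R x = c *\<^sub>R k"
  using radical_line[OF u v uv, of "R x"] assms R_J by (auto simp: I_def)

lemma k_I: "c *\<^sub>R k \<in> I"
  using u v by (simp add: I_def R_def)

lemma I_E: assumes x: "x \<in> I" shows "E x \<in> I"
proof -
  obtain c where c: "R x = c *\<^sub>R k" using I_R[OF x] .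
  have "R (E x) = E (R x)" by (simp add: R_def)
  then have "R (E x) = - c *\<^sub>R k" by (simp add: c)
  then show ?thesis using u v I_N[OF x] by (simp add: I_def)
qed

text \<open>
  On \<open>J/\<real>k\<close> the map \<open>R\<close> is \<open>1 + 2 E\<close>, and \<open>(1 + 2 E) (1 - 2 E) = 1 - 4 m\<close> is invertible there. So \<open>R x\<close>
  agrees with \<open>R j\<close> for some \<open>j\<close> in \<open>J\<close>, up to a multiple of \<open>k\<close>.
\<close>

lemma N_split: assumes x: "x \<in> N" obtains j where "j \<in> J" "x - j \<in> I"
proof -
  define p where "p = R x"
  have p: "p \<in> J" using R_J[OF x] by (simp add: p_def)
  obtain c where c: "E (E p) = m *\<^sub>R p + c *\<^sub>R k" using E_E_J[OF p] .
  define s where "s = inverse (1 - 4 * m)"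
  have s: "s * (1 - 4 * m) = 1" using m by (simp add: s_def)
  define j where "j = s *\<^sub>R (p - 2 *\<^sub>R E p)"
  have j: "j \<in> J" using p by (simp add: j_def)
  have R_j: "\<omega> z (R j) = \<omega> z p" if z: "z \<in> J" for z
  proof -
    have "\<omega> z (R j) = s * (1 - 4 * m) * \<omega> z p"
      using z by (simp add: R_def j_def c) (simp add: algebra_simps)
    then show ?thesis by (simp add: s)
  qed
  have "R (x - j) = p - R j" by (simp add: p_def linear_diff[OF linear_R])
  then have "x - j \<in> I"
    using x j R_j[OF u] R_j[OF v] by (simp add: I_def)
  then show ?thesis using j that by blast
qed

text \<open>
  \<open>k\<close> commutes with \<open>N\<close>, so \<open>\<omega> k\<close> is invariant under \<open>E\<close> on \<open>N\<close>, whereas \<open>1\<close> is not an eigenvalue of \<open>E\<close> on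
  \<open>N/J\<close>.
\<close>

lemma \<omega>_k_N: assumes x: "x \<in> N" shows "\<omega> k x = 0" "\<omega> x k = 0"
proof -
  have step: "\<omega> k (E y) = \<omega> k y" if "y \<in> N" for y
    using \<omega>_E[of k y] that by simp
  have "\<omega> k (R x) = 0" using R_J[OF x] by simp
  then have "(4 - m) * \<omega> k x = 0"
    using step[of x] step[of "E x"] x by (simp add: R_def algebra_simps)
  then show "\<omega> k x = 0" using m by simp
  then show "\<omega> x k = 0" using \<omega>_skew[of x k] by simp
qed

text \<open>
  With \<open>F = E + 1\<close> the hypothesis reads \<open>w (F x) y + w x (F y) = c w x y\<close>, and \<open>F\<^sup>2 = m\<close> modulo \<open>k\<close> on \<open>I\<close>. A sum of
  two of the eigenvalues \<open>0, \<plusminus> \<delta>\<close> of \<open>F\<close> is zero or purely imaginary, so it is not \<open>c\<close>. Both \<open>\<Omega>\<close> (with \<open>c = 1\<close>) and, once \<open>I\<close> is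
  known to be abelian, \<open>\<omega>\<close> (with \<open>c = 2\<close>) are of this kind.
\<close>

lemma scaled_derivation_form_vanishes:
  fixes w :: "'a \<Rightarrow> 'a \<Rightarrow> real"
  assumes w: "bilinear w" and w_k: "\<And>x. x \<in> N \<Longrightarrow> w k x = 0" "\<And>x. x \<in> N \<Longrightarrow> w x k = 0"
    and w_E: "\<And>x y. x \<in> I \<Longrightarrow> y \<in> I \<Longrightarrow> w (E x) y + w x (E y) = (c - 2) * w x y"
    and c: "c \<noteq> 0"
    and x: "x \<in> I" and y: "y \<in> I"
  shows "w x y = 0"
proof -
  define F where "F z = E z + z" for z
  note lin = bilinear_ladd[OF w] bilinear_radd[OF w] bilinear_lmul[OF w] bilinear_rmul[OF w]
  have F_I: "F z \<in> I" if "z \<in> I" for z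
    unfolding F_def using that I_E subspace_add[OF subspace_I] by blast
  have w_F: "w (F x) y + w x (F y) = c * w x y" if "x \<in> I" "y \<in> I" for x y
    using w_E[OF that] by (simp add: F_def lin algebra_simps)
  have F_F: "\<exists>t. F (F z) = m *\<^sub>R z + t *\<^sub>R k" if z: "z \<in> I" for z
  proof -
    obtain t where "R z = t *\<^sub>R k" using I_R[OF z] .
    moreover have "F (F z) = m *\<^sub>R z + R z" by (simp add: F_def R_def scaleR_2)
    ultimately show ?thesis by auto
  qed
  have w_FF: "w (F (F x)) y = m * w x y" "w x (F (F y)) = m * w x y" if "x \<in> I" "y \<in> I" for x y
    using F_F[OF that(1)] F_F[OF that(2)] w_k I_N that by (auto simp: lin)
  have "m * w x y + w (F x) (F y) = c * w (F x) y"
    using w_F[OF F_I[OF x] y] w_FF(1)[OF x y] by simp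
  moreover have "w (F x) (F y) + m * w x y = c * w x (F y)"
    using w_F[OF x F_I[OF y]] w_FF(2)[OF x y] by simp
  moreover have "m * w x (F y) + m * w (F x) y = c * w (F x) (F y)"
    using w_F[OF F_I[OF x] F_I[OF y]] w_FF(1)[OF x F_I[OF y]] w_FF(2)[OF F_I[OF x] y] by simp
  moreover note w_F[OF x y]
  moreover define A B C D where "A = w x y" and "B = w (F x) y" and "C = w x (F y)" and "D = w (F x) (F y)"
  ultimately have eq: "m * A + D = c * B" "D + m * A = c * C" "m * C + m * B = c * D" "B + C = c * A"
    by simp_all
  have "m * (c * A) = c * D" using eq(3,4) by (metis add.commute distrib_left)
  then have "D = m * A" using c by simp
  then have "c * B = 2 * m * A" "c * C = 2 * m * A" using eq(1,2) by linarith+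
  then have "c * (B + C) = 4 * m * A" by (simp add: distrib_left)
  then have "(c * c - 4 * m) * A = 0" by (simp add: eq(4) algebra_simps)
  moreover have "c * c - 4 * m > 0" using c m not_real_square_gt_zero[of c] by linarith
  ultimately show ?thesis by (simp add: A_def)
qed

lemma I_\<Omega>_isotropic: assumes "x \<in> I" "y \<in> I" shows "\<Omega> x y = 0"
proof (rule scaled_derivation_form_vanishes[OF bil(2) _ _ _ _ assms, of 1])
  show "\<Omega> (E x) y + \<Omega> x (E y) = (1 - 2) * \<Omega> x y" for x y using \<Omega>_E[of x y] by simp
qed simp_all

text \<open>
  Brackets of \<open>I\<close> with \<open>J\<close> are multiples of \<open>k\<close>, which both forms pair to zero with \<open>N\<close>. Closedness of
  \<open>\<Omega>\<close> then puts \<open>[x,y]\<close> into \<open>J\<close>, closedness of \<open>\<omega>\<close> puts it into \<open>\<real>k\<close>, and \<open>\<mu> [x,y] = - \<Omega> x y = 0\<close> kills it.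
\<close>

lemma I_abelian: assumes x: "x \<in> I" and y: "y \<in> I" shows "br x y = 0"
proof -
  have vanish: "w (br x y) j = 0"
    if w: "\<And>z. z \<in> N \<Longrightarrow> w k z = 0" "bilinear w"
      and closed: "w (br x y) j + w (br y j) x + w (br j x) y = 0" and j: "j \<in> J"
    for w :: "'a \<Rightarrow> 'a \<Rightarrow> real" and j
  proof -
    obtain c where c: "br y j = c *\<^sub>R k" using br_N_J[OF I_N[OF y] j] .
    obtain d where d: "br j x = - d *\<^sub>R k" using br_N_J[OF I_N[OF x] j] .
    have "w (br y j) x = 0" "w (br j x) y = 0"
      unfolding c d using w(1) I_N[OF x] I_N[OF y]
      by (simp_all only: bilinear_lmul[OF w(2)]) simp_all
    then show ?thesis using closed by simp
  qed
  have J: "br x y \<in> J"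
    by (rule J_perp[THEN iffD2], rule ballI, rule vanish[OF \<Omega>_N_k(2) bil(2) \<Omega>_closed])
  have "\<omega> j (br x y) = 0" if j: "j \<in> J" for j
    using vanish[OF \<omega>_k_N(1) bil(1) \<omega>_closed j] \<omega>_skew[of j "br x y"] by simp
  then obtain c where c: "br x y = c *\<^sub>R k" using radicalI[OF J] by blast
  have "\<mu> (br x y) = 0" using I_\<Omega>_isotropic[OF x y] by (simp add: ce_diff_def)
  then show ?thesis using c \<mu>_k lin_\<mu> by (simp add: linear_cmul)
qed

text \<open>
  Modulo \<open>I\<close> the ideal \<open>N\<close> is represented by \<open>J\<close>, whose brackets with \<open>I\<close> are multiples of \<open>k\<close>.
\<close>

lemma I_ideal: "lie_ideal br I"
proof (rule lie_idealI[OF subspace_I I_E])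
  fix x y assume x: "x \<in> I" and y: "y \<in> N"
  obtain j where j: "j \<in> J" "y - j \<in> I" using N_split[OF y] .
  obtain c where c: "br j x = - c *\<^sub>R k" using br_N_J[OF I_N[OF x] j(1)] .
  have "br (y - j) x = 0" by (rule I_abelian[OF j(2) x])
  then have "br y x = - c *\<^sub>R k" using c by (simp add: eq_neg_iff_add_eq_0)
  then show "br y x \<in> I" by (simp only: k_I)
qed

lemma I_isotropic: assumes "x \<in> I" "y \<in> I" shows "\<omega> x y = 0"
proof (rule scaled_derivation_form_vanishes[OF bil(1) _ _ _ _ assms, of 2])
  show "\<omega> (E x) y + \<omega> x (E y) = (2 - 2) * \<omega> x y" if "x \<in> I" "y \<in> I" for x y
    using \<omega>_E[OF I_abelian[OF that]] by simp
qed (simp_all add: \<omega>_k_N)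

lemma lagrangian_I: "lagrangian_ideal br \<omega> I"
proof (rule isotropic_ideal_lagrangian[OF dim6 symp I_ideal I_isotropic
      bilinear_linear_left[OF bil(2)] linear_\<omega>_R linear_\<omega>_R])
  fix x assume "\<Omega> x k = 0" "\<omega> u (R x) = 0" "\<omega> v (R x) = 0"
  then show "x \<in> I" unfolding I_def N_iff by blast
qed

end

section \<open>Existence of a Lagrangian ideal for every symplectic form\<close>

lemma (in principal_lagrangian) ex_lagrangian_ideal: "\<exists>I. lagrangian_ideal br \<omega> I"
proof -
  obtain m where m: "\<forall>j\<in>J. \<exists>c. E (E j) - m *\<^sub>R j = c *\<^sub>R k" using E_square_J ..
  show ?thesis
  proof (cases "m > 0")
    case True
    define r where "r = sqrt m"
    have r: "r > 0" "r * r = m" using True by (simp_all add: r_def)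
    have m': "\<forall>j\<in>J. \<exists>c. E (E j) - (r * r) *\<^sub>R j = c *\<^sub>R k" using m r(2) by simp
    obtain u v a where "u \<in> J" "v \<in> J" "\<omega> u v \<noteq> 0" "E u = - r *\<^sub>R u + a *\<^sub>R k"
      using ex_eigenvector[OF m' r(1)] .
    then interpret real_spectrum br \<mu> e J \<omega> k r u v a
      by unfold_locales (use r(1) m' in blast)+
    show ?thesis using lagrangian_I by blast
  next
    case False
    obtain u v where "u \<in> J" "v \<in> J" "\<omega> u v \<noteq> 0" using not_isotropic by blast
    then interpret imaginary_spectrum br \<mu> e J \<omega> k m u v
      by unfold_locales (use False m in auto)
    show ?thesis using lagrangian_I by blast
  qed
qed

theorem theorem3:
  fixes br :: "'a::real_vector \<Rightarrow> 'a \<Rightarrow> 'a"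
    and \<mu> :: "'a \<Rightarrow> real"
  assumes "lie_algebra br"
    and "dim (UNIV :: 'a set) = 6"
    and "frobeniusian br"
    and "linear \<mu>"
    and "nondegenerate (ce_diff br \<mu>)"
    and "\<exists>J. lagrangian_ideal br (ce_diff br \<mu>) J"
  shows "\<forall>\<omega>. symplectic_form br \<omega> \<longrightarrow> (\<exists>J. lagrangian_ideal br \<omega> J)"
proof (intro allI impI)
  fix \<omega> assume \<omega>: "symplectic_form br \<omega>"
  interpret lie_algebra br by fact
  have fin: "dim (UNIV :: 'a set) > 0" using assms(2) by simp
  note \<Omega> = symplectic_ce_diff[OF assms(4,5)]
  obtain J where J: "lagrangian_ideal br (ce_diff br \<mu>) J" using assms(6) ..
  have ideal: "lie_ideal br J" by (rule lagrangian_idealD[OF J])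
  have sub: "subspace J" using ideal by (simp add: lie_ideal_def)
  have perp: "form_perp (ce_diff br \<mu>) J = J"
    using J unfolding lagrangian_ideal_def by (elim conjE) (rule sym)
  have dim_J: "dim J = 3"
    using dim_form_perp[OF fin symplectic_formD(1,2)[OF \<Omega>] sub] assms(2) unfolding perp by simp
  show "\<exists>J. lagrangian_ideal br \<omega> J"
  proof (cases "\<forall>a\<in>J. \<forall>b\<in>J. \<omega> a b = 0")
    case True
    then have "J = form_perp \<omega> J"
      by (intro isotropic_half_dim_eq_perp[OF fin symplectic_formD(1,2)[OF \<omega>] sub])
        (auto simp: form_perp_def dim_J assms(2))
    then have "lagrangian_ideal br \<omega> J"
      unfolding lagrangian_ideal_def by (rule conjI[OF ideal])
    then show ?thesis ..
  next
    case False
    then obtain a b where ab: "a \<in> J" "b \<in> J" "\<omega> a b \<noteq> 0" by blast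
    then have ex: "\<exists>a\<in>J. \<exists>b\<in>J. \<omega> a b \<noteq> 0" by blast
    have skew: "skew_form \<omega>" using \<omega> by (simp add: symplectic_form_def)
    obtain k where k: "k \<in> J" "k \<noteq> 0" "\<And>x. x \<in> J \<Longrightarrow> \<omega> k x = 0"
      "\<And>a b x. a \<in> J \<Longrightarrow> b \<in> J \<Longrightarrow> \<omega> a b \<noteq> 0 \<Longrightarrow> x \<in> J \<Longrightarrow> \<omega> a x = 0 \<Longrightarrow> \<omega> b x = 0
        \<Longrightarrow> \<exists>c. x = c *\<^sub>R k"
      using dim_3_radical[OF fin skew sub dim_J ab] by metis
    obtain e where e: "ce_diff br \<mu> e y = \<mu> y" for y
      using nondegenerate_represents_functional[OF fin symplectic_formD(1,2)[OF \<Omega>] assms(4)] by metis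
    have principal: "\<mu> (br e y) = - \<mu> y" for y using e[of y] by (simp add: ce_diff_def)
    interpret principal_lagrangian br \<mu> e J \<omega> k
      by (intro principal_lagrangian.intro principal_lagrangian_axioms.intro)
        (fact assms principal J \<omega> k ex)+
    show ?thesis by (rule ex_lagrangian_ideal)
  qed
qed

end
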